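(* Let $\mathtt{k}>0$, let $\nu\in\mathbb{R}$ with $2\nu>-3\mathtt{k}$, and let $c\in\mathbb{C}$. Then the $\mathtt{k}$-Struve function $y=\mathtt{S}_{\nu,c}^{\mathtt{k}}(x)$ satisfies, for $x>0$, the second-order non-homogeneous differential equation $$x^2\frac{d^2y}{dx^2}+x\frac{dy}{dx}+\frac{1}{\mathtt{k}^2}\left(c\,\mathtt{k}\,x^2-\nu^2\right)y=\frac{4\left(\frac{x}{2}\right)^{\frac{\nu}{\mathtt{k}}+1}}{\mathtt{k}\,\Gamma_{\mathtt{k}}\left(\nu+\frac{\mathtt{k}}{2}\right)\Gamma\left(\frac12\right)}.$$
   Context: For $\mathtt{k}>0$, the $\mathtt{k}$-gamma function is $\Gamma_{\mathtt{k}}(x)=\int_0^\infty t^{x-1}e^{-t^{\mathtt{k}}/\mathtt{k}}\,dt$ for $\Re(x)>0$, extended to other arguments by $\Gamma_{\mathtt{k}}(x+\mathtt{k})=x\,\Gamma_{\mathtt{k}}(x)$, with the convention that $1/\Gamma_{\mathtt{k}}$ equals $0$ at the poles $0,-\mathtt{k},-2\mathtt{k},\dots$ of $\Gamma_{\mathtt{k}}$; $\Gamma$ is the usual gamma function. The $\mathtt{k}$-Struve function is $$\mathtt{S}_{\nu,c}^{\mathtt{k}}(x)=\sum_{r=0}^{\infty}\frac{(-c)^r}{\Gamma_{\mathtt{k}}\left(r\mathtt{k}+\nu+\frac{3\mathtt{k}}{2}\right)\Gamma\left(r+\frac32\right)}\left(\frac{x}{2}\right)^{2r+\frac{\nu}{\mathtt{k}}+1}\qquad(x>0).$$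 *)

theory Defs
  imports "HOL-Analysis.Analysis"
begin

(* The integral for Re x > 0, continued to Re x <= 0 by Gamma_k(x) = Gamma_k(x + k) / x.
   At the poles 0, -k, -2k, ... division by zero makes the value 0, as for the library's Gamma,
   so that 1 / k_Gamma k x = 0 there, which is the usual convention for 1 / Gamma_k.
   Only k > 0 is meaningful; the test 0 < k in the condition is there for termination. *)
function k_Gamma :: "real \<Rightarrow> complex \<Rightarrow> complex" where
  "k_Gamma k x =
     (if 0 < k \<and> Re x \<le> 0 then k_Gamma k (x + of_real k) / x
      else integral {0<..}
             (\<lambda>t::real. of_real t powr (x - 1) * of_real (exp (- (t powr k) / k))))"
  by pat_completeness auto
termination
proof (relation "Wellfounded.measure (\<lambda>(k, x). nat \<lceil>1 - Re x / k\<rceil>)")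
  fix k :: real and x :: complex
  assume kx: "0 < k \<and> Re x \<le> 0"
  then have "1 - Re (x + of_real k) / k = (1 - Re x / k) - 1" and "1 \<le> 1 - Re x / k"
    by (simp_all add: add_divide_distrib divide_nonpos_pos)
  then have "\<lceil>1 - Re (x + of_real k) / k\<rceil> = \<lceil>1 - Re x / k\<rceil> - 1" and "1 \<le> \<lceil>1 - Re x / k\<rceil>"
    by linarith+
  then show "((k, x + of_real k), (k, x)) \<in> Wellfounded.measure (\<lambda>(k, x). nat \<lceil>1 - Re x / k\<rceil>)"
    by simp
qed simp

declare k_Gamma.simps [simp del]

definition k_Struve :: "real \<Rightarrow> real \<Rightarrow> complex \<Rightarrow> real \<Rightarrow> complex" where
  "k_Struve k \<nu> c x =
     (\<Sum>r. (- c) ^ r /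
            (k_Gamma k (of_real (real r * k + \<nu> + 3 * k / 2)) * Gamma (of_nat r + 3 / 2)) *
          of_real ((x / 2) powr (2 * real r + \<nu> / k + 1)))"

end

theory Submission
  imports Defs
begin

text \<open>
  With \<open>p = \<nu> / k + 1\<close> the \<open>k\<close>-Struve function is a series \<open>\<Sum>n. a n * (x / 2) powr (2 * n + p)\<close>
  whose coefficients decay so fast that \<open>\<Sum>n. a n * z ^ n\<close> is entire. The Euler operator
  \<open>x * d/dx\<close> acts on such a series diagonally, multiplying the \<open>n\<close>-th coefficient by \<open>2 * n + p\<close>
  (\<open>euler_operator_bessel_series\<close>). Since \<open>x\<^sup>2 y'' + x y'\<close> is the Euler operator applied twice,
  the part \<open>x\<^sup>2 y'' + x y' - (\<nu> / k)\<^sup>2 y\<close> of the equation multiplies the \<open>n\<close>-th coefficient by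
  \<open>(2 * n + p)\<^sup>2 - (p - 1)\<^sup>2 = 4 * (n + 1 / 2) * (n + 1 / 2 + \<nu> / k)\<close>.

  The functional equations of \<open>Gamma\<close> and of \<open>k_Gamma\<close> absorb these two factors: what is left at
  index \<open>n + 1\<close> is \<open>- 4 * c / k\<close> times the coefficient \<open>a n\<close>. So the term
  \<open>(c / k) * x\<^sup>2 * y\<close>, which shifts the index by one, telescopes against it, and
  only the contribution of index \<open>0\<close> survives. This is the right-hand side of the equation.

  The functional equation of \<open>k_Gamma\<close> to the right of the imaginary axis follows from
  that of \<open>Gamma\<close>, because the substitution \<open>u = t powr k / k\<close> turns the defining integral into
  Euler's integral (\<open>k_Gamma_eq_Gamma\<close>).
\<close>

section \<open>The functional equation of the k-gamma function\<close>

text \<open>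
  The substitution \<open>u = t powr k / k\<close> has \<open>du = t powr (k - 1) dt\<close> and turns
  \<open>u powr (z / k - 1)\<close> into \<open>t powr (z - k)\<close> divided by the constant \<open>k powr (z / k - 1)\<close>.
\<close>

lemma k_Gamma_eq_Gamma:
  fixes k :: real and z :: complex
  assumes "k > 0" and "Re z > 0"
  shows "k_Gamma k z = of_real k powr (z / of_real k - 1) * Gamma (z / of_real k)"
proof -
  define f where "f = (\<lambda>u::real. of_real u powr (z / of_real k - 1) / of_real (exp u) :: complex)"
  define g where "g = (\<lambda>t::real. t powr k / k)"
  define C where "C = complex_of_real k powr (z / of_real k - 1)"
  have C: "C \<noteq> 0"
    using assms(1) by (simp add: C_def)
  have image_g: "g ` {0<..} = {0<..}"
  proof
    show "g ` {0<..} \<subseteq> {0<..}"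
      using assms(1) by (auto simp: g_def)
    show "{0<..} \<subseteq> g ` {0<..}"
    proof
      fix u :: real assume "u \<in> {0<..}"
      with assms(1) have "g ((k * u) powr (1 / k)) = u" "(k * u) powr (1 / k) > 0"
        by (auto simp: g_def powr_powr)
      then show "u \<in> g ` {0<..}"
        by (metis greaterThan_iff image_eqI)
    qed
  qed
  have inj_g: "inj_on g {0<..}"
  proof (rule inj_onI)
    fix s t assume st: "s \<in> {0<..}" "t \<in> {0<..}" "g s = g t"
    then have "(s powr k) powr (1 / k) = (t powr k) powr (1 / k)"
      using assms(1) by (simp add: g_def)
    with st assms(1) show "s = t"
      by (simp add: powr_powr)
  qed
  have der_g: "(g has_field_derivative t powr (k - 1)) (at t within {0<..})" if "t \<in> {0<..}" for t
    using that assms(1) unfolding g_def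
    by (auto intro!: derivative_eq_intros)
  have integrand: "\<bar>t powr (k - 1)\<bar> *\<^sub>R f (g t) =
      (1 / C) * (of_real t powr (z - 1) * of_real (exp (- (t powr k) / k)))"
    if "t \<in> {0<..}" for t
  proof -
    have t: "t > 0" using that by simp
    have "g t > 0" "ln (g t) = k * ln t - ln k"
      using t assms(1) by (simp_all add: g_def ln_div ln_powr)
    then have "complex_of_real (g t) powr (z / of_real k - 1) =
        exp ((z / of_real k - 1) * (of_real k * of_real (ln t) - of_real (ln k)))"
      by (simp add: powr_def Ln_of_real)
    also have "\<dots> = exp ((z - of_real k) * of_real (ln t)) / C"
      using assms(1)
      by (simp add: C_def powr_def Ln_of_real exp_diff[symmetric] algebra_simps)
    finally have "complex_of_real (g t) powr (z / of_real k - 1) =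
        exp ((z - of_real k) * of_real (ln t)) / C" .
    moreover have "complex_of_real (t powr (k - 1)) * exp ((z - of_real k) * of_real (ln t)) =
        of_real t powr (z - 1)"
      using t by (simp add: powr_def Ln_of_real algebra_simps flip: exp_of_real exp_add)
    ultimately show ?thesis
      by (simp add: f_def g_def scaleR_conv_of_real exp_minus field_simps)
  qed
  have "f absolutely_integrable_on {0<..}" "integral {0<..} f = Gamma (z / of_real k)"
    unfolding f_def using assms
    by (auto intro!: absolutely_integrable_Gamma_integral' integral_unique Gamma_integral_complex')
  then have "Gamma (z / of_real k) = integral {0<..} (\<lambda>t. \<bar>t powr (k - 1)\<bar> *\<^sub>R f (g t))"
    using has_absolute_integral_change_of_variables_real[OF _ der_g inj_g, of f "Gamma (z / of_real k)"]
    by (simp add: image_g)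
  also have "\<dots> = integral {0<..} (\<lambda>t. (1 / C) *
      (of_real t powr (z - 1) * of_real (exp (- (t powr k) / k))))"
    by (intro integral_cong integrand)
  also have "\<dots> = (1 / C) * k_Gamma k z"
    using assms by (subst k_Gamma.simps) simp
  finally show ?thesis
    using C by (simp add: C_def field_simps)
qed

text \<open>
  In the half-plane \<open>Re z \<le> 0\<close> this is how \<open>k_Gamma\<close> is continued, and for \<open>Re z > 0\<close>
  Euler's integral has the corresponding property. The functional equation is put in terms of the
  reciprocal: unlike \<open>k_Gamma k (z + k) = z * k_Gamma k z\<close>, this form also holds at \<open>z = 0\<close>,
  where both sides vanish.
\<close>

lemma inverse_k_Gamma_shift:
  fixes k :: real and z :: complex
  assumes "k > 0"
  shows "z * inverse (k_Gamma k (z + of_real k)) = inverse (k_Gamma k z)"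
proof (cases "Re z > 0")
  case False
  then have "k_Gamma k z = k_Gamma k (z + of_real k) / z"
    using assms by (subst k_Gamma.simps) simp
  then show ?thesis
    by (simp add: divide_inverse)
next
  case True
  define w where "w = z / of_real k"
  have "Re w > 0"
    using True assms by (simp add: w_def)
  then have w: "w \<notin> \<int>\<^sub>\<le>\<^sub>0"
    by (auto elim!: nonpos_Ints_cases)
  have zw: "z = of_real k * w" "(z + of_real k) / of_real k = w + 1"
    using assms by (simp_all add: w_def field_simps)
  have "k_Gamma k (z + of_real k) = of_real k powr w * (w * Gamma w)"
    using assms True w by (simp add: k_Gamma_eq_Gamma zw(2) Gamma_plus1)
  also have "complex_of_real k powr w = of_real k * of_real k powr (w - 1)"
    using assms by (simp add: powr_diff)
  finally have "k_Gamma k (z + of_real k) = z * k_Gamma k z"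
    using assms True by (simp add: k_Gamma_eq_Gamma zw(1))
  moreover have "z \<noteq> 0"
    using True by auto
  ultimately show ?thesis
    by simp
qed

section \<open>The Euler operator on series of Bessel type\<close>

definition bessel_series :: "(nat \<Rightarrow> complex) \<Rightarrow> real \<Rightarrow> real \<Rightarrow> complex" where
  "bessel_series a p x = (\<Sum>n. a n * of_real ((x / 2) powr (2 * real n + p)))"

lemma sums_of_nat_mult_power_series:
  fixes a :: "nat \<Rightarrow> complex"
  assumes "\<And>z. summable (\<lambda>n. a n * z ^ n)"
  shows "(\<lambda>n. of_nat n * a n * z ^ n) sums (z * (\<Sum>n. diffs a n * z ^ n))"
proof -
  have "(\<lambda>n. z * (of_nat n * a n * z ^ (n - Suc 0))) sums (z * (\<Sum>n. diffs a n * z ^ n))"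
    by (intro sums_mult diffs_equiv termdiff_converges_all assms)
  moreover have "z * (of_nat n * a n * z ^ (n - Suc 0)) = of_nat n * a n * z ^ n" for n
    by (cases n) auto
  ultimately show ?thesis
    by simp
qed

lemma summable_euler_coeffs:
  fixes a :: "nat \<Rightarrow> complex" and p :: real
  assumes "\<And>z. summable (\<lambda>n. a n * z ^ n)"
  shows "summable (\<lambda>n. of_real (2 * real n + p) * a n * z ^ n)"
proof -
  have "summable (\<lambda>n. 2 * (of_nat n * a n * z ^ n) + of_real p * (a n * z ^ n))"
    using sums_of_nat_mult_power_series[of a z] assms
    by (intro summable_add summable_mult) (auto simp: sums_iff)
  then show ?thesis
    by (simp add: algebra_simps)
qed

lemma bessel_series_term:
  fixes a :: "nat \<Rightarrow> complex" and p x :: real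
  assumes "x > 0"
  shows "a n * of_real ((x / 2) powr (2 * real n + p)) =
    of_real ((x / 2) powr p) * (a n * of_real ((x / 2)\<^sup>2) ^ n)"
proof -
  have "(x / 2) powr (2 * real n) = ((x / 2)\<^sup>2) ^ n"
    using assms powr_realpow[of "x / 2" "2 * n"] by (simp add: power_mult)
  then show ?thesis
    by (simp add: powr_add mult_ac)
qed

lemma bessel_series_eq_power_series:
  assumes "x > 0" and "\<And>z. summable (\<lambda>n. a n * z ^ n)"
  shows "bessel_series a p x = of_real ((x / 2) powr p) * (\<Sum>n. a n * of_real ((x / 2)\<^sup>2) ^ n)"
  unfolding bessel_series_def bessel_series_term[OF assms(1)]
  by (intro suminf_mult assms)

lemma bessel_series_sums:
  assumes "x > 0" and "\<And>z. summable (\<lambda>n. a n * z ^ n)"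
  shows "(\<lambda>n. a n * of_real ((x / 2) powr (2 * real n + p))) sums bessel_series a p x"
  unfolding bessel_series_def
  by (rule summable_sums) (simp only: bessel_series_term[OF assms(1)] summable_mult assms(2))

text \<open>
  Differentiating \<open>(x / 2) powr (2 * n + p)\<close> and multiplying by \<open>x\<close> gives the factor \<open>2 * n + p\<close>.
  The series may be differentiated term by term because it is \<open>(x / 2) powr p\<close> times an entire
  function of \<open>(x / 2)\<^sup>2\<close>.
\<close>

lemma euler_operator_bessel_series:
  fixes a :: "nat \<Rightarrow> complex" and p x :: real
  assumes "x > 0" and a: "\<And>z. summable (\<lambda>n. a n * z ^ n)"
  shows "(bessel_series a p has_vector_derivative
           bessel_series (\<lambda>n. of_real (2 * real n + p) * a n) p x / of_real x) (at x)"
proof -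
  define F where "F = (\<lambda>z. \<Sum>n. a n * z ^ n)"
  define F' where "F' = (\<lambda>z. \<Sum>n. diffs a n * z ^ n)"
  define q where "q = complex_of_real ((x / 2)\<^sup>2)"
  have der_F: "(F has_field_derivative F' z) (at z)" for z
    unfolding F_def F'_def by (rule termdiffs_strong_converges_everywhere[OF a])
  have der_inner: "((\<lambda>x::real. of_real ((x / 2)\<^sup>2) :: complex) has_vector_derivative of_real (x / 2)) (at x)"
    by (auto intro!: derivative_eq_intros simp: has_vector_derivative_def of_real_def)
  have der_comp: "((\<lambda>x. F (of_real ((x / 2)\<^sup>2))) has_vector_derivative of_real (x / 2) * F' q) (at x)"
    using field_vector_diff_chain_at[OF der_inner der_F] by (simp add: o_def q_def)
  have "((\<lambda>x. (x / 2) powr p) has_real_derivative p * (x / 2) powr p / x) (at x)"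
    using assms(1) by (auto intro!: derivative_eq_intros simp: powr_diff)
  then have der_powr: "((\<lambda>x. complex_of_real ((x / 2) powr p)) has_vector_derivative
      of_real (p * (x / 2) powr p / x)) (at x)"
    by (rule has_vector_derivative_of_real)
  have der: "((\<lambda>x. of_real ((x / 2) powr p) * F (of_real ((x / 2)\<^sup>2))) has_vector_derivative
      of_real ((x / 2) powr p) * (of_real (x / 2) * F' q) +
      of_real (p * (x / 2) powr p / x) * F q) (at x)"
    using has_vector_derivative_mult[OF der_powr der_comp] by (simp add: q_def)
  have "(\<lambda>n. 2 * (of_nat n * a n * q ^ n) + of_real p * (a n * q ^ n)) sums
      (2 * (q * F' q) + of_real p * F q)"
    unfolding F_def F'_def
    by (intro sums_add sums_mult sums_of_nat_mult_power_series summable_sums a)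
  then have "(\<lambda>n. of_real (2 * real n + p) * a n * q ^ n) sums (2 * (q * F' q) + of_real p * F q)"
    by (simp add: algebra_simps)
  then have "bessel_series (\<lambda>n. of_real (2 * real n + p) * a n) p x =
      of_real ((x / 2) powr p) * (2 * (q * F' q) + of_real p * F q)"
    using bessel_series_eq_power_series[OF assms(1) summable_euler_coeffs[OF a]]
    by (simp add: q_def sums_iff)
  then have "bessel_series (\<lambda>n. of_real (2 * real n + p) * a n) p x / of_real x =
      of_real ((x / 2) powr p) * (of_real (x / 2) * F' q) + of_real (p * (x / 2) powr p / x) * F q"
    using assms(1) by (simp add: q_def field_simps power2_eq_square)
  with der have "((\<lambda>x. of_real ((x / 2) powr p) * F (of_real ((x / 2)\<^sup>2))) has_vector_derivative
      bessel_series (\<lambda>n. of_real (2 * real n + p) * a n) p x / of_real x) (at x)"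
    by simp
  then show ?thesis
    by (rule has_vector_derivative_transform_within_open[where S = "{0<..}"])
       (use assms(1) in \<open>auto simp: F_def bessel_series_eq_power_series[OF _ a]\<close>)
qed

section \<open>The coefficients of the k-Struve function\<close>

definition k_Struve_coeff :: "real \<Rightarrow> real \<Rightarrow> complex \<Rightarrow> nat \<Rightarrow> complex" where
  "k_Struve_coeff k \<nu> c n =
     (- c) ^ n / (k_Gamma k (of_real (real n * k + \<nu> + 3 * k / 2)) * Gamma (of_nat n + 3 / 2))"

lemma k_Struve_eq_bessel_series:
  "k_Struve k \<nu> c = bessel_series (k_Struve_coeff k \<nu> c) (\<nu> / k + 1)"
  by (simp add: fun_eq_iff k_Struve_def bessel_series_def k_Struve_coeff_def add.assoc)

text \<open>
  For \<open>p = \<nu> / k + 1\<close> the multiplier on the left is \<open>k / 4\<close> times \<open>(2 * n + p)\<^sup>2 - (p - 1)\<^sup>2\<close>.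
  Each of its two factors lowers the argument of one gamma function by one step. The argument
  \<open>n * k + \<nu> + k / 2\<close> can be a pole, for instance \<open>0\<close> when \<open>n = 0\<close> and \<open>\<nu> = - k / 2\<close>, hence the
  reciprocal form of the functional equation.
\<close>

lemma k_Struve_coeff_absorb:
  assumes "k > 0"
  shows "of_real ((real n + 1 / 2) * (real n * k + \<nu> + k / 2)) * k_Struve_coeff k \<nu> c n =
    (- c) ^ n / (k_Gamma k (of_real (real n * k + \<nu> + k / 2)) * Gamma (of_nat n + 1 / 2))"
proof -
  define z where "z = complex_of_real (real n * k + \<nu> + k / 2)"
  define w where "w = complex_of_real (real n + 1 / 2)"
  have "Re w > 0"
    by (simp add: w_def)
  then have "w \<notin> \<int>\<^sub>\<le>\<^sub>0"
    by (auto elim!: nonpos_Ints_cases)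
  then have Gamma_w: "Gamma (w + 1) = w * Gamma w" and "w \<noteq> 0"
    by (auto simp: Gamma_plus1)
  have args: "complex_of_real (real n * k + \<nu> + 3 * k / 2) = z + of_real k"
    "of_nat n + 3 / 2 = w + 1" "of_nat n + 1 / 2 = w"
    by (simp_all add: z_def w_def)
  have "of_real ((real n + 1 / 2) * (real n * k + \<nu> + k / 2)) * k_Struve_coeff k \<nu> c n =
      w * z * ((- c) ^ n / (k_Gamma k (z + of_real k) * (w * Gamma w)))"
    unfolding k_Struve_coeff_def args Gamma_w by (simp only: of_real_mult z_def w_def)
  also have "\<dots> = (- c) ^ n * ((z * inverse (k_Gamma k (z + of_real k))) * inverse (Gamma w))"
    using \<open>w \<noteq> 0\<close> by (simp add: divide_inverse)
  also have "\<dots> = (- c) ^ n * (inverse (k_Gamma k z) * inverse (Gamma w))"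
    by (simp only: inverse_k_Gamma_shift[OF assms])
  also have "\<dots> = (- c) ^ n / (k_Gamma k z * Gamma w)"
    by (simp add: divide_inverse)
  finally show ?thesis
    by (simp only: args(3) z_def)
qed

lemma k_Struve_coeff_Suc:
  assumes "k > 0"
  shows "of_real ((real n + 3 / 2) * (real n * k + \<nu> + 3 * k / 2)) * k_Struve_coeff k \<nu> c (Suc n) =
    - c * k_Struve_coeff k \<nu> c n"
proof -
  have shift: "real (Suc n) + 1 / 2 = real n + 3 / 2"
    "real (Suc n) * k + \<nu> + k / 2 = real n * k + \<nu> + 3 * k / 2"
    "of_nat (Suc n) + 1 / 2 = (of_nat n + 3 / 2 :: complex)"
    by (simp_all add: field_simps)
  show ?thesis
    using k_Struve_coeff_absorb[OF assms, of "Suc n" \<nu> c]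
    unfolding shift by (simp add: k_Struve_coeff_def)
qed

text \<open>
  The ratio of consecutive terms is \<open>- c * z / d\<close> with \<open>d\<close> growing quadratically in \<open>n\<close>.
\<close>

lemma summable_k_Struve_coeff:
  assumes "k > 0" and "2 * \<nu> > - 3 * k"
  shows "summable (\<lambda>n. k_Struve_coeff k \<nu> c n * z ^ n)"
proof (rule summable_ratio_test)
  define a where "a = k_Struve_coeff k \<nu> c"
  fix n assume n: "n \<ge> nat \<lceil>2 * norm (c * z) / k\<rceil>"
  define d where "d = (real n + 3 / 2) * (real n * k + \<nu> + 3 * k / 2)"
  have "2 * norm (c * z) / k \<le> real n"
    using n by linarith
  then have "2 * norm (c * z) \<le> 1 * (real n * k)"
    using assms(1) by (simp add: field_simps)
  also have "\<dots> \<le> d"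
    unfolding d_def using assms by (intro mult_mono) auto
  finally have bound: "2 * norm (c * z) \<le> d" .
  have "real n * k \<ge> 0"
    using assms(1) by simp
  then have "d > 0"
    unfolding d_def using assms(2) by (intro mult_pos_pos) linarith+
  have "of_real d * a (Suc n) = - c * a n"
    unfolding a_def d_def by (rule k_Struve_coeff_Suc[OF assms(1)])
  then have "of_real d * (a (Suc n) * z ^ Suc n) = - (c * z) * (a n * z ^ n)"
    by (simp only: mult.assoc[symmetric] power_Suc2) (simp add: mult_ac)
  then have "d * norm (a (Suc n) * z ^ Suc n) = norm (c * z) * norm (a n * z ^ n)"
    using \<open>d > 0\<close> by (metis abs_of_pos norm_minus_cancel norm_mult norm_of_real)
  also have "\<dots> \<le> d / 2 * norm (a n * z ^ n)"
    using bound by (intro mult_right_mono) auto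
  finally have "d * norm (a (Suc n) * z ^ Suc n) \<le> d * (1 / 2 * norm (a n * z ^ n))"
    by simp
  then show "norm (a (Suc n) * z ^ Suc n) \<le> 1 / 2 * norm (a n * z ^ n)"
    using \<open>d > 0\<close> by (rule mult_left_le_imp_le)
qed auto

section \<open>The differential equation\<close>

theorem proposition3p1:
  fixes k \<nu> :: real and c :: complex
  assumes "k > 0" and "2 * \<nu> > - 3 * k"
  shows "\<exists>y' y'' :: real \<Rightarrow> complex. \<forall>x>0.
           (k_Struve k \<nu> c has_vector_derivative y' x) (at x) \<and>
           (y' has_vector_derivative y'' x) (at x) \<and>
           of_real (x\<^sup>2) * y'' x + of_real x * y' x
             + 1 / of_real (k\<^sup>2) * (c * of_real k * of_real (x\<^sup>2) - of_real (\<nu>\<^sup>2)) * k_Struve k \<nu> c x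
           = 4 * of_real ((x / 2) powr (\<nu> / k + 1))
             / (of_real k * k_Gamma k (of_real (\<nu> + k / 2)) * Gamma (1 / 2))"
proof -
  define p where "p = \<nu> / k + 1"
  define a where "a = k_Struve_coeff k \<nu> c"
  \<comment> \<open>The coefficients after one and two applications of the Euler operator.\<close>
  define a1 where "a1 = (\<lambda>n. of_real (2 * real n + p) * a n)"
  define a2 where "a2 = (\<lambda>n. of_real (2 * real n + p) * a1 n)"
  define y' where "y' = (\<lambda>x. bessel_series a1 p x / of_real x)"
  define y'' where "y'' = (\<lambda>x. (bessel_series a2 p x - bessel_series a1 p x) / of_real (x\<^sup>2))"
  have y: "k_Struve k \<nu> c = bessel_series a p"
    by (simp add: k_Struve_eq_bessel_series a_def p_def)
  have summ: "summable (\<lambda>n. a n * z ^ n)" for z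
    unfolding a_def by (rule summable_k_Struve_coeff[OF assms])
  have summ1: "summable (\<lambda>n. a1 n * z ^ n)" for z
    unfolding a1_def by (rule summable_euler_coeffs[OF summ])
  have summ2: "summable (\<lambda>n. a2 n * z ^ n)" for z
    unfolding a2_def by (rule summable_euler_coeffs[OF summ1])
  have der: "(bessel_series a p has_vector_derivative y' x) (at x)" if "x > 0" for x
    unfolding y'_def a1_def by (rule euler_operator_bessel_series[OF that summ])
  have der': "(y' has_vector_derivative y'' x) (at x)" if "x > 0" for x
  proof -
    have "((\<lambda>x. inverse (complex_of_real x)) has_vector_derivative of_real (- inverse (x\<^sup>2))) (at x)"
      using that
      by (auto intro!: derivative_eq_intros has_vector_derivative_of_real simp flip: of_real_inverse
          simp: power2_eq_square)
    from has_vector_derivative_mult[OF euler_operator_bessel_series[OF that summ1, of p, folded a2_def] this]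
    show ?thesis
      using that by (simp add: y'_def y''_def divide_inverse power2_eq_square algebra_simps)
  qed
  have ode: "of_real (x\<^sup>2) * y'' x + of_real x * y' x
      + 1 / of_real (k\<^sup>2) * (c * of_real k * of_real (x\<^sup>2) - of_real (\<nu>\<^sup>2)) * bessel_series a p x
      = 4 * of_real ((x / 2) powr p)
        / (of_real k * k_Gamma k (of_real (\<nu> + k / 2)) * Gamma (1 / 2))" if "x > 0" for x
  proof -
    define t where "t = (\<lambda>n. complex_of_real ((x / 2) powr (2 * real n + p)))"
    \<comment> \<open>The \<open>b n\<close> are the coefficients of \<open>x\<^sup>2 y'' + x y' - (\<nu> / k)\<^sup>2 y\<close>.\<close>
    define b where "b = (\<lambda>n. a2 n - of_real ((\<nu> / k)\<^sup>2) * a n)"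
    have t_Suc: "t (Suc n) = of_real (x\<^sup>2 / 4) * t n" for n
    proof -
      have "(x / 2) powr (2 * real (Suc n) + p) = (x / 2) powr 2 * (x / 2) powr (2 * real n + p)"
        by (simp add: powr_add[symmetric] algebra_simps)
      also have "(x / 2) powr 2 = x\<^sup>2 / 4"
        using that by (simp add: power_divide)
      finally show ?thesis
        by (simp only: t_def of_real_mult)
    qed
    have b: "b n = 4 / of_real k * (of_real ((real n + 1 / 2) * (real n * k + \<nu> + k / 2)) * a n)" for n
    proof -
      have "(2 * real n + p)\<^sup>2 - (\<nu> / k)\<^sup>2 = 4 / k * ((real n + 1 / 2) * (real n * k + \<nu> + k / 2))"
        using assms(1) by (simp add: p_def field_simps power2_eq_square)
      then have "complex_of_real ((2 * real n + p)\<^sup>2 - (\<nu> / k)\<^sup>2) =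
          of_real (4 / k * ((real n + 1 / 2) * (real n * k + \<nu> + k / 2)))"
        by (simp only:)
      moreover have "b n = of_real ((2 * real n + p)\<^sup>2 - (\<nu> / k)\<^sup>2) * a n"
        by (simp add: b_def a2_def a1_def algebra_simps power2_eq_square)
      ultimately show ?thesis
        by (simp add: mult.assoc)
    qed
    have b_Suc: "b (Suc n) = - (4 * c / of_real k) * a n" for n
    proof -
      have shift: "real (Suc n) + 1 / 2 = real n + 3 / 2"
        "real (Suc n) * k + \<nu> + k / 2 = real n * k + \<nu> + 3 * k / 2"
        by (simp_all add: field_simps)
      show ?thesis
        unfolding b a_def shift k_Struve_coeff_Suc[OF assms(1)] by simp
    qed
    have b_0: "b 0 = 4 / (of_real k * k_Gamma k (of_real (\<nu> + k / 2)) * Gamma (1 / 2))"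
      using k_Struve_coeff_absorb[OF assms(1), of 0 \<nu> c] unfolding b a_def by simp
    have "(\<lambda>n. a2 n * t n - of_real ((\<nu> / k)\<^sup>2) * (a n * t n)) sums
        (bessel_series a2 p x - of_real ((\<nu> / k)\<^sup>2) * bessel_series a p x)"
      unfolding t_def by (intro sums_diff sums_mult bessel_series_sums that summ summ2)
    then have "(\<lambda>n. b n * t n) sums
        (bessel_series a2 p x - of_real ((\<nu> / k)\<^sup>2) * bessel_series a p x)"
      by (simp add: b_def algebra_simps)
    then have "(\<lambda>n. b (Suc n) * t (Suc n)) sums
        (bessel_series a2 p x - of_real ((\<nu> / k)\<^sup>2) * bessel_series a p x - b 0 * t 0)"
      by (simp only: sums_Suc_iff[of "\<lambda>n. b n * t n"] diff_add_cancel)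
    moreover have "(\<lambda>n. - (c / of_real k * of_real (x\<^sup>2)) * (a n * t n)) sums
        (- (c / of_real k * of_real (x\<^sup>2)) * bessel_series a p x)"
      unfolding t_def by (intro sums_mult bessel_series_sums that summ)
    moreover have "b (Suc n) * t (Suc n) = - (c / of_real k * of_real (x\<^sup>2)) * (a n * t n)" for n
      by (simp add: b_Suc t_Suc)
    \<comment> \<open>Without its first term, the series with coefficients \<open>b\<close> is termwise \<open>- (c / k) * x\<^sup>2 * y\<close>.\<close>
    ultimately have telescoped: "bessel_series a2 p x - of_real ((\<nu> / k)\<^sup>2) * bessel_series a p x - b 0 * t 0 =
        - (c / of_real k * of_real (x\<^sup>2)) * bessel_series a p x"
      by (metis (no_types, lifting) sums_cong sums_unique2)
    have "of_real (x\<^sup>2) * y'' x + of_real x * y' x = bessel_series a2 p x"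
      using that by (simp add: y'_def y''_def)
    moreover have "1 / of_real (k\<^sup>2) * (c * of_real k * of_real (x\<^sup>2) - of_real (\<nu>\<^sup>2)) =
        c / of_real k * of_real (x\<^sup>2) - complex_of_real ((\<nu> / k)\<^sup>2)"
      using assms(1) by (simp add: field_simps power2_eq_square)
    ultimately have "of_real (x\<^sup>2) * y'' x + of_real x * y' x
        + 1 / of_real (k\<^sup>2) * (c * of_real k * of_real (x\<^sup>2) - of_real (\<nu>\<^sup>2)) * bessel_series a p x
        = b 0 * t 0"
      using telescoped by (simp only:) (simp add: algebra_simps)
    then show ?thesis
      by (simp add: b_0 t_def)
  qed
  show ?thesis
    unfolding y using der der' ode unfolding p_def by blast
qed

end
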